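(* Let $\mathcal{Q}$ be a parallelogram polyomino, let $\mathcal{Q}'$ be a sub-polyomino of $\mathcal{Q}$ which is also a parallelogram polyomino, and let $\mathcal{P}=\mathcal{Q}\setminus\mathcal{Q}'$ (assumed non-empty). Let $K$ be a field, $S=K[x_a\mid a\in V(\mathcal{P})]$, and let $V_1,\dots,V_s$ and $\mathcal{C}_1,\dots,\mathcal{C}_s$ be the vertex sets and cell sets associated with $\mathcal{P}$ (defined in the context). Put $a=\min\{i: V_i\cap V(\mathcal{Q}')\ne\varnothing\}$, $b=\max\{i: V_i\cap V(\mathcal{Q}')\neq\varnothing\}$, $\mathcal{Q}_1=\bigcup_{i<b}\mathcal{C}_i$ and $\mathcal{Q}_2=\bigcup_{i>a}\mathcal{C}_i$. Suppose that $I_{\mathcal{Q}_1}+I_{\mathcal{Q}_2}=I_{\mathcal{P}}$ (as ideals of $S$). Then the set of all quadratic binomials corresponding to inner intervals of $\mathcal{P}$ forms a Gröbner basis of $I_{\mathcal{P}}$ with respect to the graded reverse lexicographic order $<$ on $S$ induced by: $x_{i,j}<x_{k,l}$ if $i<k$, or $i=k$ and $j<l$.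
   Context: $\mathbb{N}$ is the set of nonnegative integers, and $(i,j)\le (k,l)$ in $\mathbb{N}^2$ means $i\le k$ and $j\le l$. For $a=(i,j)\le b=(k,l)$ put $[a,b]=\{m\in\mathbb{N}^2: a\le m\le b\}$; it is a proper interval if $i<k$ and $j<l$. The diagonal vertices of a proper interval are $a$ (lower-left) and $b$ (upper-right), and its anti-diagonal vertices are $(i,l)$ (upper-left) and $(k,j)$ (lower-right). A cell is $C=[a,a+(1,1)]$; $V(C)$ is the set of its four vertices and its edges are the four pairs of adjacent vertices. For a finite collection of cells $\mathcal{P}$, $V(\mathcal{P})=\bigcup_{C\in\mathcal{P}}V(C)$. A polyomino is a non-empty finite collection of cells in $(\mathbb{N}\setminus\{0\})^2$ such that any two of its cells $C,D$ are joined by a sequence of cells $C=C_1,\dots,C_m=D$ of the collection with $C_i\cap C_{i+1}$ an edge of both for all $i$. A sub-polyomino of $\mathcal{Q}$ is a polyomino all of whose cells are in $\mathcal{Q}$. $\mathcal{Q}\setminus\mathcal{Q}'$ is the collection of cells of $\mathcal{Q}$ not in $\mathcal{Q}'$ (it need not be a polyomino). A polyomino is horizontally convex if whenever two of its cells have lower-left vertices $(i,j)$ and $(k,j)$ with $k>i$, every cell with lower-left vertex $(l,j)$, $i\le l\le k$, belongs to it; vertically convex is defined analogously; convex means both. A parallelogram polyomino is a convex polyomino whose vertex set is a sub-lattice of $\mathbb{N}^2$. For a collection of cells $\mathcal{P}'$, an inner interval is a proper interval $[a,b]$ with $a,b\in V(\mathcal{P}')$ all of whose cells belong to $\mathcal{P}'$;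 the corresponding binomial is $x_ax_b-x_cx_d$, where $c,d$ are the anti-diagonal vertices of $[a,b]$; $I_{\mathcal{P}'}$ is the ideal generated by these binomials. For sub-collections of $\mathcal{P}$ these ideals are taken in $S$. The sets $V_k$ and $\mathcal{C}_k$ for $\mathcal{P}$: partition $V(\mathcal{P})$ into sets $V_1,\dots,V_s$, $V_k=\{v_{k,1},\dots,v_{k,n_k}\}$, such that: (i) for $1\le i<n_k$, $v_{k,i}$ and $v_{k,i+1}$ are respectively the upper-left and lower-right vertices of a cell of $\mathcal{P}$; (ii) $v_{k,1}$ is not a lower-right vertex, and $v_{k,n_k}$ is not an upper-left vertex, of any cell of $\mathcal{P}$; (iii) for $k<l$, with $v_{k,1}=(v_1,v_2)$ and $v_{l,1}=(w_1,w_2)$, either $v_1+v_2<w_1+w_2$, or $v_1+v_2=w_1+w_2$ and $v_1<w_1$. If $V_k$ is a singleton, $\mathcal{C}_k=\varnothing$; otherwise $\mathcal{C}_k=\{C_{k,1},\dots,C_{k,n_k-1}\}$, where $C_{k,i}$ is the cell of $\mathcal{P}$ with anti-diagonal vertices $v_{k,i}$ and $v_{k,i+1}$, $1\le i\le n_k-1$. *)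

theory Defs
  imports
    "HOL-Algebra.Ideal"
    "HOL-Library.Poly_Mapping"
    "HOL-Library.Disjoint_Sets"
    "HOL-Library.Product_Order"
    "HOL-Library.Product_Plus"
begin

text \<open>
  The order on \<^typ>\<open>nat \<times> nat\<close> is the componentwise one of \<^theory>\<open>HOL-Library.Product_Order\<close>,
  so that \<^term>\<open>{a..b}\<close> is the interval $[a,b]$ of $\mathbb{N}^2$. The cell $[c, c + (1,1)]$ is
  represented by its lower-left vertex \<^term>\<open>c\<close>.
\<close>

type_synonym point = "nat \<times> nat"
type_synonym cell = point

definition upper_left :: "cell \<Rightarrow> point" where
  "upper_left c = c + (0, 1)"

definition lower_right :: "cell \<Rightarrow> point" where
  "lower_right c = c + (1, 0)"

definition cell_vertices :: "cell \<Rightarrow> point set" where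
  "cell_vertices c = {c, lower_right c, upper_left c, c + (1, 1)}"

definition cell_edges :: "cell \<Rightarrow> point set set" where
  "cell_edges c = {{c, lower_right c}, {c, upper_left c},
     {lower_right c, c + (1, 1)}, {upper_left c, c + (1, 1)}}"

definition vertices :: "cell set \<Rightarrow> point set" where
  "vertices P = (\<Union>c\<in>P. cell_vertices c)"

lemma cell_vertices_eq_interval: "cell_vertices c = {c..c + (1, 1)}"
proof (cases c)
  case (Pair i j)
  have "k = i \<or> k = Suc i" "l = j \<or> l = Suc j" if "(i, j) \<le> (k, l)" "(k, l) \<le> (Suc i, Suc j)" for k l
    using that by auto
  then show ?thesis
    unfolding Pair cell_vertices_def lower_right_def upper_left_def by fastforce
qed

definition adjacent_cells :: "cell \<Rightarrow> cell \<Rightarrow> bool" where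
  "adjacent_cells C D \<longleftrightarrow> cell_vertices C \<inter> cell_vertices D \<in> cell_edges C \<inter> cell_edges D"

definition polyomino :: "cell set \<Rightarrow> bool" where
  "polyomino P \<longleftrightarrow> finite P \<and> P \<noteq> {} \<and> (\<forall>c\<in>P. 0 < fst c \<and> 0 < snd c) \<and>
     (\<forall>C\<in>P. \<forall>D\<in>P. (C, D) \<in> {(A, B). A \<in> P \<and> B \<in> P \<and> adjacent_cells A B}\<^sup>*)"

definition sub_polyomino :: "cell set \<Rightarrow> cell set \<Rightarrow> bool" where
  "sub_polyomino Q' Q \<longleftrightarrow> polyomino Q' \<and> Q' \<subseteq> Q"

definition horizontally_convex :: "cell set \<Rightarrow> bool" where
  "horizontally_convex P \<longleftrightarrow>
     (\<forall>i j k. (i, j) \<in> P \<longrightarrow> (k, j) \<in> P \<longrightarrow> i < k \<longrightarrow> (\<forall>l\<in>{i..k}. (l, j) \<in> P))"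

definition vertically_convex :: "cell set \<Rightarrow> bool" where
  "vertically_convex P \<longleftrightarrow>
     (\<forall>i j k. (i, j) \<in> P \<longrightarrow> (i, k) \<in> P \<longrightarrow> j < k \<longrightarrow> (\<forall>l\<in>{j..k}. (i, l) \<in> P))"

definition sublattice :: "'a::lattice set \<Rightarrow> bool" where
  "sublattice L \<longleftrightarrow> (\<forall>u\<in>L. \<forall>v\<in>L. inf u v \<in> L \<and> sup u v \<in> L)"

definition parallelogram_polyomino :: "cell set \<Rightarrow> bool" where
  "parallelogram_polyomino P \<longleftrightarrow>
     polyomino P \<and> horizontally_convex P \<and> vertically_convex P \<and> sublattice (vertices P)"

definition proper_interval :: "point \<Rightarrow> point \<Rightarrow> bool" where
  "proper_interval a b \<longleftrightarrow> fst a < fst b \<and> snd a < snd b"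

definition inner_intervals :: "cell set \<Rightarrow> (point \<times> point) set" where
  "inner_intervals P = {(a, b). proper_interval a b \<and> a \<in> vertices P \<and> b \<in> vertices P \<and>
     (\<forall>c. cell_vertices c \<subseteq> {a..b} \<longrightarrow> c \<in> P)}"

text \<open>
  The partition $V_1, \dots, V_s$ is a list of lists \<^term>\<open>vs\<close>: its entry \<^term>\<open>vs ! k\<close>
  is the list $v_{k+1,1}, \dots, v_{k+1,n_{k+1}}$. Indices therefore start from 0 instead of 1.
\<close>

definition antidiagonal_partition :: "cell set \<Rightarrow> point list list \<Rightarrow> bool" where
  "antidiagonal_partition P vs \<longleftrightarrow>
     partition_on (vertices P) (set (map set vs)) \<and> distinct (map set vs) \<and>
     (\<forall>v\<in>set vs. distinct v \<and>
        (\<forall>i. Suc i < length v \<longrightarrow> (\<exists>c\<in>P. v ! i = upper_left c \<and> v ! Suc i = lower_right c)) \<and>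
        (\<forall>c\<in>P. hd v \<noteq> lower_right c \<and> last v \<noteq> upper_left c)) \<and>
     (\<forall>k l. k < l \<longrightarrow> l < length vs \<longrightarrow>
        (case (hd (vs ! k), hd (vs ! l)) of ((v1, v2), (w1, w2)) \<Rightarrow>
           v1 + v2 < w1 + w2 \<or> v1 + v2 = w1 + w2 \<and> v1 < w1))"

definition antidiagonal_cells :: "cell set \<Rightarrow> point list \<Rightarrow> cell set" where
  "antidiagonal_cells P v =
     {c \<in> P. \<exists>i. Suc i < length v \<and> v ! i = upper_left c \<and> v ! Suc i = lower_right c}"

text \<open>
  A monomial is a finitely supported exponent function, and a polynomial is a finitely supported
  function from monomials to coefficients. Only indeterminates from \<^term>\<open>A\<close> occur in the
  elements of $K[x_a \mid a \in A]$, where $K$ is the coefficient type.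
\<close>

type_synonym 'v monomial = "'v \<Rightarrow>\<^sub>0 nat"
type_synonym ('v, 'k) polynomial = "'v monomial \<Rightarrow>\<^sub>0 'k"

definition poly_ring :: "'v set \<Rightarrow> ('v, 'k::field) polynomial ring" where
  "poly_ring A = \<lparr>carrier = {p. \<forall>m\<in>Poly_Mapping.keys p. Poly_Mapping.keys m \<subseteq> A},
     mult = (*), one = 1, zero = 0, add = (+)\<rparr>"

lemma cring_poly_ring: "cring (poly_ring A :: ('v, 'k::field) polynomial ring)"
proof (rule cringI)
  have plus: "p + q \<in> carrier (poly_ring A)"
    if "p \<in> carrier (poly_ring A)" "q \<in> carrier (poly_ring A)" for p q :: "('v, 'k) polynomial"
    using that Poly_Mapping.keys_add[of p q] by (fastforce simp: poly_ring_def)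
  have uminus: "- p \<in> carrier (poly_ring A)"
    if "p \<in> carrier (poly_ring A)" for p :: "('v, 'k) polynomial"
    using that by (simp add: poly_ring_def)
  have times: "p * q \<in> carrier (poly_ring A)"
    if "p \<in> carrier (poly_ring A)" "q \<in> carrier (poly_ring A)" for p q :: "('v, 'k) polynomial"
  proof -
    have "Poly_Mapping.keys m \<subseteq> A" if "m \<in> Poly_Mapping.keys (p * q)" for m
    proof -
      obtain a b where "m = a + b" "a \<in> Poly_Mapping.keys p" "b \<in> Poly_Mapping.keys q"
        using \<open>m \<in> Poly_Mapping.keys (p * q)\<close> keys_mult[of p q] by blast
      then show ?thesis
        using \<open>p \<in> carrier _\<close> \<open>q \<in> carrier _\<close> Poly_Mapping.keys_add[of a b]
        by (fastforce simp: poly_ring_def)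
    qed
    then show ?thesis by (simp add: poly_ring_def)
  qed
  have zero_one: "0 \<in> carrier (poly_ring A :: ('v, 'k) polynomial ring)"
    "1 \<in> carrier (poly_ring A :: ('v, 'k) polynomial ring)"
    by (simp_all add: poly_ring_def)
  have ops: "x \<oplus>\<^bsub>poly_ring A\<^esub> y = x + y" "x \<otimes>\<^bsub>poly_ring A\<^esub> y = x * y"
    "\<zero>\<^bsub>poly_ring A\<^esub> = (0 :: ('v, 'k) polynomial)" "\<one>\<^bsub>poly_ring A\<^esub> = (1 :: ('v, 'k) polynomial)"
    for x y :: "('v, 'k) polynomial"
    by (simp_all add: poly_ring_def)
  show "abelian_group (poly_ring A :: ('v, 'k) polynomial ring)"
    by (rule abelian_groupI)
      (auto simp: ops plus zero_one algebra_simps intro!: bexI[OF _ uminus])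
  show "comm_monoid (poly_ring A :: ('v, 'k) polynomial ring)"
    by (rule comm_monoidI) (auto simp: ops times zero_one algebra_simps)
qed (simp add: poly_ring_def algebra_simps)

definition indet :: "'v \<Rightarrow> ('v, 'k::field) polynomial" where
  "indet v = Poly_Mapping.single (Poly_Mapping.single v 1) 1"

definition interval_binomial :: "point \<Rightarrow> point \<Rightarrow> (point, 'k::field) polynomial" where
  "interval_binomial a b = indet a * indet b - indet (fst a, snd b) * indet (fst b, snd a)"

definition inner_binomials :: "cell set \<Rightarrow> (point, 'k::field) polynomial set" where
  "inner_binomials P = {interval_binomial a b | a b. (a, b) \<in> inner_intervals P}"

definition cells_ideal ::
  "(point, 'k::field) polynomial ring \<Rightarrow> cell set \<Rightarrow> (point, 'k) polynomial set" where
  "cells_ideal S P = Idl\<^bsub>S\<^esub> (inner_binomials P)"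

definition monomial_degree :: "'v monomial \<Rightarrow> nat" where
  "monomial_degree m = (\<Sum>v\<in>Poly_Mapping.keys m. Poly_Mapping.lookup m v)"

text \<open>
  For monomials of equal degree, the smaller one is the one with the larger exponent at the
  smallest indeterminate where the exponents differ.
\<close>

definition grevlex_less :: "('v \<Rightarrow> 'v \<Rightarrow> bool) \<Rightarrow> 'v monomial \<Rightarrow> 'v monomial \<Rightarrow> bool" where
  "grevlex_less lt s t \<longleftrightarrow> monomial_degree s < monomial_degree t \<or>
     monomial_degree s = monomial_degree t \<and>
     (\<exists>v. Poly_Mapping.lookup t v < Poly_Mapping.lookup s v \<and>
        (\<forall>w. lt w v \<longrightarrow> Poly_Mapping.lookup s w = Poly_Mapping.lookup t w))"

definition indet_less :: "point \<Rightarrow> point \<Rightarrow> bool" where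
  "indet_less = (\<lambda>(i, j) (k, l). i < k \<or> i = k \<and> j < l)"

definition leading_monomial ::
  "('v monomial \<Rightarrow> 'v monomial \<Rightarrow> bool) \<Rightarrow> ('v, 'k::field) polynomial \<Rightarrow> 'v monomial" where
  "leading_monomial lt p = (THE m. m \<in> Poly_Mapping.keys p \<and>
     (\<forall>m'\<in>Poly_Mapping.keys p. m' \<noteq> m \<longrightarrow> lt m' m))"

definition initial_ideal ::
  "('v, 'k::field) polynomial ring \<Rightarrow> ('v monomial \<Rightarrow> 'v monomial \<Rightarrow> bool) \<Rightarrow>
   ('v, 'k) polynomial set \<Rightarrow> ('v, 'k) polynomial set" where
  "initial_ideal S lt F =
     Idl\<^bsub>S\<^esub> {Poly_Mapping.single (leading_monomial lt f) 1 | f. f \<in> F \<and> f \<noteq> 0}"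

definition groebner_basis ::
  "('v, 'k::field) polynomial ring \<Rightarrow> ('v monomial \<Rightarrow> 'v monomial \<Rightarrow> bool) \<Rightarrow>
   ('v, 'k) polynomial set \<Rightarrow> ('v, 'k) polynomial set \<Rightarrow> bool" where
  "groebner_basis S lt G I \<longleftrightarrow>
     finite G \<and> G \<subseteq> I \<and> 0 \<notin> G \<and> initial_ideal S lt G = initial_ideal S lt I"

end

theory Submission
  imports Defs
begin

text \<open>
  In the given term order the leading monomial of $x_a x_b - x_c x_d$ is the anti-diagonal one,
  $x_c x_d$. Replacing anti-diagonal pairs by diagonal pairs of inner intervals is a terminating
  rewriting of monomials; once it is confluent, the ideal is the kernel of the normal form map and
  the binomials form a Groebner basis. Two replacements that overlap in an upper-left or in a
  lower-right vertex can always be joined. If the lower-right vertex of one interval is the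
  upper-left vertex $v$ of the other, they can be joined as soon as one of the two remaining
  quadrants at $v$ is an interval as well. For $\mathcal{Q} \setminus \mathcal{Q}'$ this holds:
  the two quadrants lie in $\mathcal{Q}$, and if $\mathcal{Q}'$ met both of them, its
  connectedness would make it meet one of the two given intervals.
\<close>

section \<open>Parallelogram polyominoes\<close>

lemma cell_edges_cases:
  assumes "e \<in> cell_edges (x, y)"
  obtains y' where "e = {(x, y'), (Suc x, y')}" "y' = y \<or> y' = Suc y"
    | x' where "e = {(x', y), (x', Suc y)}" "x' = x \<or> x' = Suc x"
  using assms unfolding cell_edges_def upper_left_def lower_right_def by auto

lemma adjacent_cells_cases:
  assumes "adjacent_cells (x, y) (x', y')"
  shows "x = x' \<and> (y = y' \<or> y = Suc y' \<or> y' = Suc y) \<or> y = y' \<and> (x = Suc x' \<or> x' = Suc x)"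
proof -
  have "cell_edges (x, y) \<inter> cell_edges (x', y') \<noteq> {}"
    using assms by (auto simp: adjacent_cells_def)
  then obtain e where e: "e \<in> cell_edges (x, y)" "e \<in> cell_edges (x', y')" by blast
  from e(1) show ?thesis
  proof (cases rule: cell_edges_cases)
    case (1 v)
    from e(2) show ?thesis
      by (cases rule: cell_edges_cases) (use 1 in \<open>auto simp: doubleton_eq_iff\<close>)
  next
    case (2 u)
    from e(2) show ?thesis
      by (cases rule: cell_edges_cases) (use 2 in \<open>auto simp: doubleton_eq_iff\<close>)
  qed
qed

text \<open>A path of cells from \<open>C\<close> to \<open>D\<close> starts in \<open>W\<close> and
  ends outside, so some step of it leaves \<open>W\<close>. Connectedness enters the later arguments
  in this form.\<close>

lemma polyomino_crossing:
  assumes "polyomino P" "C \<in> P" "D \<in> P" "C \<in> W" "D \<notin> W"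
  obtains E F where "E \<in> P" "E \<in> W" "F \<in> P" "F \<notin> W" "adjacent_cells E F"
proof -
  have "(C, D) \<in> {(A, B). A \<in> P \<and> B \<in> P \<and> adjacent_cells A B}\<^sup>*"
    using assms unfolding polyomino_def by blast
  then have "D \<notin> W \<Longrightarrow> \<exists>E F. E \<in> P \<and> E \<in> W \<and> F \<in> P \<and> F \<notin> W \<and> adjacent_cells E F"
    using \<open>C \<in> W\<close> by (induction rule: rtrancl_induct) auto
  with \<open>D \<notin> W\<close> that show thesis by blast
qed

lemma horizontally_convexD:
  assumes "horizontally_convex P" "(i, j) \<in> P" "(k, j) \<in> P" "i \<le> l" "l \<le> k"
  shows "(l, j) \<in> P"
proof (cases "i < k")
  case True
  then show ?thesis using assms unfolding horizontally_convex_def by (meson atLeastAtMost_iff)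
next
  case False
  then have "l = i" using assms by simp
  then show ?thesis using assms by simp
qed

lemma vertically_convexD:
  assumes "vertically_convex P" "(i, j) \<in> P" "(i, k) \<in> P" "j \<le> l" "l \<le> k"
  shows "(i, l) \<in> P"
proof (cases "j < k")
  case True
  then show ?thesis using assms unfolding vertically_convex_def by (meson atLeastAtMost_iff)
next
  case False
  then have "l = j" using assms by simp
  then show ?thesis using assms by simp
qed

lemma vertices_iff:
  "(x, y) \<in> vertices P \<longleftrightarrow>
     (\<exists>x' y'. (x', y') \<in> P \<and> (x = x' \<or> x = Suc x') \<and> (y = y' \<or> y = Suc y'))"
proof
  assume "(x, y) \<in> vertices P"
  then obtain x' y' where "(x', y') \<in> P" "(x, y) \<in> cell_vertices (x', y')"
    unfolding vertices_def by auto
  then show "\<exists>x' y'. (x', y') \<in> P \<and> (x = x' \<or> x = Suc x') \<and> (y = y' \<or> y = Suc y')"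
    by (auto simp: cell_vertices_def upper_left_def lower_right_def)
next
  assume "\<exists>x' y'. (x', y') \<in> P \<and> (x = x' \<or> x = Suc x') \<and> (y = y' \<or> y = Suc y')"
  then obtain x' y' where c: "(x', y') \<in> P" "x = x' \<or> x = Suc x'" "y = y' \<or> y = Suc y'" by blast
  then have "(x, y) \<in> cell_vertices (x', y')"
    by (auto simp: cell_vertices_def upper_left_def lower_right_def)
  with c(1) show "(x, y) \<in> vertices P"
    unfolding vertices_def by blast
qed

text \<open>The join of the upper-right vertices of the two cells is a vertex, so one of the four
  cells around it lies in \<open>P\<close>. Unless this is the one to the upper right, the claim is
  immediate or follows by convexity along a row or column.\<close>

lemma parallelogram_sup:
  assumes P: "parallelogram_polyomino P"
    and A: "(x1, y1) \<in> P" and B: "(x2, y2) \<in> P" and le: "x1 \<le> x2" "y2 \<le> y1"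
  shows "(x2, y1) \<in> P"
proof -
  note h = horizontally_convexD[of P] and v = vertically_convexD[of P]
  have hc: "horizontally_convex P" and vc: "vertically_convex P" and sl: "sublattice (vertices P)"
    and pol: "polyomino P"
    using P by (auto simp: parallelogram_polyomino_def)
  have "(Suc x1, Suc y1) \<in> vertices P" "(Suc x2, Suc y2) \<in> vertices P"
    using A B by (auto simp: vertices_iff)
  then have "sup (Suc x1, Suc y1) (Suc x2, Suc y2) \<in> vertices P"
    using sl unfolding sublattice_def by blast
  moreover have "sup (Suc x1, Suc y1) (Suc x2, Suc y2) = (Suc x2, Suc y1)"
    using le by (simp add: sup_prod_def sup_nat_def)
  ultimately have "(Suc x2, Suc y1) \<in> vertices P" by simp
  then consider "(x2, y1) \<in> P" | "(Suc x2, y1) \<in> P" | "(x2, Suc y1) \<in> P"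
    | "(Suc x2, Suc y1) \<in> P"
    unfolding vertices_iff by auto
  then show ?thesis
  proof cases
    case 1
    then show ?thesis .
  next
    case 2
    then show ?thesis using h[OF hc A] le by simp
  next
    case 3
    then show ?thesis using v[OF vc B] le by simp
  next
    case 4
    \<comment> \<open>A path from \<open>(x1, y1)\<close> to the cell beyond the join leaves the
      quadrant below and left of it across its right or upper side. The crossing cell and convexity
      then lead back to one of the earlier cases.\<close>
    obtain E F where EF: "E \<in> P" "E \<in> {..x2} \<times> {..y1}" "F \<in> P" "F \<notin> {..x2} \<times> {..y1}"
      "adjacent_cells E F"
      by (rule polyomino_crossing[OF pol A 4, of "{..x2} \<times> {..y1}"]) (use le in auto)
    obtain x y x' y' where [simp]: "E = (x, y)" "F = (x', y')" by (cases E, cases F) auto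
    consider "x' = Suc x2" "y' \<le> y1" | "y' = Suc y1" "x' \<le> x2"
      using EF adjacent_cells_cases[of x y x' y'] by fastforce
    then show ?thesis
    proof cases
      case 1
      then have "(Suc x2, y1) \<in> P" using v[OF vc, of "Suc x2" y' "Suc y1" y1] EF 4 by simp
      then show ?thesis using h[OF hc A] le by simp
    next
      case 2
      then have "(x2, Suc y1) \<in> P" using h[OF hc, of x' "Suc y1" "Suc x2" x2] EF 4 by simp
      then show ?thesis using v[OF vc B] le by simp
    qed
  qed
qed

text \<open>The ranges are half-open because a cell is named by its lower-left vertex. Degenerate
  rectangles are included, so that subrectangles may collapse in the joining arguments without a
  separate case.\<close>

definition filled :: "cell set \<Rightarrow> nat \<Rightarrow> nat \<Rightarrow> nat \<Rightarrow> nat \<Rightarrow> bool" where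
  "filled P i j k l \<longleftrightarrow> i \<le> k \<and> j \<le> l \<and> {i..<k} \<times> {j..<l} \<subseteq> P"

lemma filled_subset:
  assumes "filled P i j k l" "i \<le> i'" "i' \<le> k'" "k' \<le> k" "j \<le> j'" "j' \<le> l'" "l' \<le> l"
  shows "filled P i' j' k' l'"
proof -
  have "{i'..<k'} \<times> {j'..<l'} \<subseteq> {i..<k} \<times> {j..<l}"
    using assms by (intro Sigma_mono) auto
  then show ?thesis using assms unfolding filled_def by blast
qed

lemma filled_append_horizontal:
  assumes "filled P i j p l" "filled P p j k l"
  shows "filled P i j k l"
proof -
  have "{i..<k} = {i..<p} \<union> {p..<k}" using assms by (auto simp: filled_def)
  then show ?thesis using assms by (simp add: filled_def Sigma_Un_distrib1)
qed

lemma filled_append_vertical: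
  assumes "filled P i j k q" "filled P i q k l"
  shows "filled P i j k l"
proof -
  have "{j..<l} = {j..<q} \<union> {q..<l}" using assms by (auto simp: filled_def)
  then show ?thesis using assms by (simp add: filled_def Sigma_Un_distrib2)
qed

lemma inner_intervals_iff:
  "((i, j), (k, l)) \<in> inner_intervals P \<longleftrightarrow> i < k \<and> j < l \<and> filled P i j k l"
proof
  assume I: "((i, j), (k, l)) \<in> inner_intervals P"
  have "(x, y) \<in> P" if "x \<in> {i..<k}" "y \<in> {j..<l}" for x y
  proof -
    have "cell_vertices (x, y) \<subseteq> {(i, j)..(k, l)}"
      using that by (auto simp: cell_vertices_def upper_left_def lower_right_def)
    then show ?thesis using I unfolding inner_intervals_def by blast
  qed
  then show "i < k \<and> j < l \<and> filled P i j k l"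
    using I by (auto simp: inner_intervals_def proper_interval_def filled_def)
next
  assume f: "i < k \<and> j < l \<and> filled P i j k l"
  \<comment> \<open>The two corner cells on the diagonal supply the diagonal vertices; the
    predecessors are genuine since \<open>i < k\<close> and \<open>j < l\<close>.\<close>
  have "(i, j) \<in> P" "(k - 1, l - 1) \<in> P" using f by (auto simp: filled_def)
  then have "(i, j) \<in> vertices P" "(k, l) \<in> vertices P"
    using f unfolding vertices_iff by (blast, intro exI[of _ "k - 1"] exI[of _ "l - 1"]) auto
  moreover have "c \<in> P" if "cell_vertices c \<subseteq> {(i, j)..(k, l)}" for c
    using that f by (cases c) (auto simp: cell_vertices_def filled_def)
  ultimately show "((i, j), (k, l)) \<in> inner_intervals P"
    using f by (auto simp: inner_intervals_def proper_interval_def)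
qed

lemma filled_corners_in_vertices:
  assumes "i < k" "j < l" "filled P i j k l"
  shows "{(i, j), (k, l), (i, l), (k, j)} \<subseteq> vertices P"
proof -
  have "(i, j) \<in> P" "(k - 1, l - 1) \<in> P" "(i, l - 1) \<in> P" "(k - 1, j) \<in> P"
    using assms by (auto simp: filled_def)
  moreover have "k = Suc (k - 1)" "l = Suc (l - 1)" using assms by auto
  ultimately have "(i, j) \<in> vertices P" "(k, l) \<in> vertices P" "(i, l) \<in> vertices P"
    "(k, j) \<in> vertices P"
    unfolding vertices_iff by metis+
  then show ?thesis by simp
qed

text \<open>Order-reversed form of \<open>parallelogram_sup\<close>: the meet of the lower-left
  vertices is a vertex, and a path is followed only when the cell containing it lies diagonally
  below.\<close>

lemma parallelogram_inf:
  assumes P: "parallelogram_polyomino P"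
    and A: "(x1, y1) \<in> P" and B: "(x2, y2) \<in> P" and le: "x1 \<le> x2" "y2 \<le> y1"
  shows "(x1, y2) \<in> P"
proof -
  note h = horizontally_convexD[of P] and v = vertically_convexD[of P]
  have hc: "horizontally_convex P" and vc: "vertically_convex P" and sl: "sublattice (vertices P)"
    and pol: "polyomino P"
    using P by (auto simp: parallelogram_polyomino_def)
  have "(x1, y1) \<in> vertices P" "(x2, y2) \<in> vertices P"
    using A B by (auto simp: vertices_iff)
  then have "inf (x1, y1) (x2, y2) \<in> vertices P"
    using sl unfolding sublattice_def by blast
  moreover have "inf (x1, y1) (x2, y2) = (x1, y2)"
    using le by (simp add: inf_prod_def inf_nat_def)
  ultimately have "(x1, y2) \<in> vertices P" by simp
  then obtain x0 y0 where C: "(x0, y0) \<in> P" "x1 = x0 \<or> x1 = Suc x0" "y2 = y0 \<or> y2 = Suc y0"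
    unfolding vertices_iff by auto
  show ?thesis
  proof (cases "x0 = x1 \<or> y0 = y2")
    case True
    then show ?thesis
      using h[OF hc, of x0 y2 x2 x1] v[OF vc, of x1 y0 y1 y2] A B C le by auto
  next
    case False
    with C have x1: "x1 = Suc x0" and y2: "y2 = Suc y0" by auto
    obtain E F where EF: "E \<in> P" "E \<in> {x1..} \<times> {y2..}" "F \<in> P" "F \<notin> {x1..} \<times> {y2..}"
      "adjacent_cells E F"
      by (rule polyomino_crossing[OF pol A C(1), of "{x1..} \<times> {y2..}"]) (use le x1 in auto)
    obtain x y x' y' where [simp]: "E = (x, y)" "F = (x', y')" by (cases E, cases F) auto
    consider "x' = x0" "y2 \<le> y'" | "y' = y0" "x1 \<le> x'"
      using EF adjacent_cells_cases[of x y x' y'] x1 y2 by fastforce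
    then show ?thesis
    proof cases
      case 1
      then have "(x0, y2) \<in> P" using v[OF vc, of x0 y0 y' y2] EF C y2 by simp
      then show ?thesis using h[OF hc _ B] le x1 by simp
    next
      case 2
      then have "(x1, y0) \<in> P" using h[OF hc, of x0 y0 x' x1] EF C x1 by simp
      then show ?thesis using v[OF vc _ A] le y2 by simp
    qed
  qed
qed

text \<open>A path from \<open>(d1, d2)\<close> to \<open>(c1, c2)\<close> leaves the quadrant of
  cells below and left of the point \<open>(p, q)\<close> through column \<open>p\<close> or through
  row \<open>q\<close>.\<close>

lemma parallelogram_corner:
  assumes P: "parallelogram_polyomino P" and D: "(d1, d2) \<in> P" and C: "(c1, c2) \<in> P"
    and "d1 < p" "p \<le> c1" "d2 < q" "q \<le> c2"
  shows "(\<exists>y. d2 \<le> y \<and> y < q \<and> (p, y) \<in> P) \<or> (\<exists>x. d1 \<le> x \<and> x < p \<and> (x, q) \<in> P)"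
proof -
  have pol: "polyomino P" using P by (simp add: parallelogram_polyomino_def)
  obtain E F where EF: "E \<in> P" "E \<in> {..<p} \<times> {..<q}" "F \<in> P" "F \<notin> {..<p} \<times> {..<q}"
    "adjacent_cells E F"
    by (rule polyomino_crossing[OF pol D C, of "{..<p} \<times> {..<q}"]) (use assms in auto)
  obtain x y x' y' where [simp]: "E = (x, y)" "F = (x', y')" by (cases E, cases F) auto
  consider "x' = p" "y' < q" | "y' = q" "x' < p"
    using EF adjacent_cells_cases[of x y x' y'] by fastforce
  then show ?thesis
  proof cases
    case 1
    show ?thesis
    proof (cases "d2 \<le> y'")
      case True
      then show ?thesis using 1 EF by auto
    next
      case False
      \<comment> \<open>A crossing below row \<open>d2\<close> is lifted to that row:
        \<open>(p, d2)\<close> is the upper-right completion of the crossing cell and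
        \<open>(d1, d2)\<close>.\<close>
      then have "(p, d2) \<in> P" using parallelogram_sup[OF P D, of p y'] 1 EF assms by simp
      then show ?thesis using assms by auto
    qed
  next
    case 2
    show ?thesis
    proof (cases "d1 \<le> x'")
      case True
      then show ?thesis using 2 EF by auto
    next
      case False
      then have "(d1, q) \<in> P" using parallelogram_sup[OF P _ D, of x' q] 2 EF assms by simp
      then show ?thesis using assms by auto
    qed
  qed
qed

text \<open>The condition for joining two exchanges that share the point \<open>(p, q)\<close>, as
  lower-right vertex of one interval and upper-left vertex of the other. All four rectangles meet at
  \<open>(p, q)\<close>.\<close>

definition corner_filling :: "cell set \<Rightarrow> bool" where
  "corner_filling P \<longleftrightarrow> (\<forall>i j p q k l. i < p \<longrightarrow> p < k \<longrightarrow> j < q \<longrightarrow> q < l \<longrightarrow>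
     filled P i q p l \<longrightarrow> filled P p j k q \<longrightarrow> filled P i j p q \<or> filled P p q k l)"

lemma corner_filling_Diff_parallelogram:
  assumes Q: "parallelogram_polyomino Q" and Q': "parallelogram_polyomino Q'"
  shows "corner_filling (Q - Q')"
  unfolding corner_filling_def
proof (intro allI impI, rule ccontr)
  fix i j p q k l
  assume less: "i < p" "p < k" "j < q" "q < l"
    and NW: "filled (Q - Q') i q p l" and SE: "filled (Q - Q') p j k q"
    and not: "\<not> (filled (Q - Q') i j p q \<or> filled (Q - Q') p q k l)"
  have nw: "(x, y) \<in> Q - Q'" if "i \<le> x" "x < p" "q \<le> y" "y < l" for x y
    using NW that unfolding filled_def by (elim conjE, elim subsetD) simp
  have se: "(x, y) \<in> Q - Q'" if "p \<le> x" "x < k" "j \<le> y" "y < q" for x y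
    using SE that unfolding filled_def by (elim conjE, elim subsetD) simp
  \<comment> \<open>Lower-left completion of \<open>(x, q)\<close> in the upper-left rectangle and
    \<open>(p, y)\<close> in the lower-right one.\<close>
  have "(x, y) \<in> Q" if "i \<le> x" "x < p" "j \<le> y" "y < q" for x y
    using parallelogram_inf[OF Q, of x q p y] nw[of x q] se[of p y] that less by simp
  moreover obtain d where "d \<in> {i..<p} \<times> {j..<q}" "d \<notin> Q - Q'"
    using not less unfolding filled_def by (meson less_imp_le subsetI)
  ultimately obtain d1 d2 where d: "i \<le> d1" "d1 < p" "j \<le> d2" "d2 < q" "(d1, d2) \<in> Q'"
    by auto
  \<comment> \<open>Upper-right completion, from the last column \<open>p - 1\<close> of the
    upper-left rectangle and the last row \<open>q - 1\<close> of the lower-right one.\<close>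
  have "(x, y) \<in> Q" if "p \<le> x" "x < k" "q \<le> y" "y < l" for x y
    using parallelogram_sup[OF Q, of "p - 1" y x "q - 1"] nw[of "p - 1" y] se[of x "q - 1"] that less
    by auto
  moreover obtain c where "c \<in> {p..<k} \<times> {q..<l}" "c \<notin> Q - Q'"
    using not less unfolding filled_def by (meson less_imp_le subsetI)
  ultimately obtain c1 c2 where c: "p \<le> c1" "c1 < k" "q \<le> c2" "c2 < l" "(c1, c2) \<in> Q'"
    by auto
  \<comment> \<open>The cell of \<open>Q'\<close> obtained here lies in column \<open>p\<close>
    below row \<open>q\<close> or in row \<open>q\<close> left of column \<open>p\<close>, hence in
    one of the two given rectangles.\<close>
  from parallelogram_corner[OF Q' d(5) c(5) d(2) c(1) d(4) c(3)] show False
  proof (elim disjE exE conjE)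
    fix y assume "d2 \<le> y" "y < q" "(p, y) \<in> Q'"
    then show False using se[of p y] d less by simp
  next
    fix x assume "d1 \<le> x" "x < p" "(x, q) \<in> Q'"
    then show False using nw[of x q] d less by simp
  qed
qed

section \<open>Monomials and polynomials\<close>

text \<open>A form of Newman's lemma: under local confluence and termination, a normal form
  reachable from \<open>x\<close> stays reachable after any step.\<close>

lemma exchanges_to_normal_form:
  fixes \<mu> :: "'a \<Rightarrow> nat"
  assumes local_confluence: "\<And>x y z. r x y \<Longrightarrow> r x z \<Longrightarrow> \<exists>w. r\<^sup>*\<^sup>* y w \<and> r\<^sup>*\<^sup>* z w"
    and decreasing: "\<And>x y. r x y \<Longrightarrow> \<mu> y < \<mu> x"
    and normal: "\<And>y. \<not> r n y"
  shows "r\<^sup>*\<^sup>* x n \<Longrightarrow> r x y \<Longrightarrow> r\<^sup>*\<^sup>* y n"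
proof (induction "\<mu> x" arbitrary: x y rule: less_induct)
  case less
  have "x \<noteq> n" using less.prems normal by blast
  with less.prems obtain x1 where x1: "r x x1" "r\<^sup>*\<^sup>* x1 n" by (metis converse_rtranclpE)
  then obtain z where z: "r\<^sup>*\<^sup>* x1 z" "r\<^sup>*\<^sup>* y z" using local_confluence less.prems by blast
  \<comment> \<open>All elements on the path from \<open>x1\<close> to \<open>z\<close> have measure
    below \<open>\<mu> x\<close>, so the outer induction hypothesis carries reachability of
    \<open>n\<close> along it.\<close>
  from z(1) have "r\<^sup>*\<^sup>* z n \<and> \<mu> z < \<mu> x"
  proof (induction rule: rtranclp_induct)
    case base
    then show ?case using x1 decreasing by blast
  next
    case (step a b)
    then show ?case using less.hyps[of a b] decreasing[of a b] by simp
  qed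
  with z show ?case by (meson rtranclp_trans)
qed

section \<open>Weights and degrees of monomials, coefficient sums of polynomials\<close>

definition weighted_degree :: "('v \<Rightarrow> nat) \<Rightarrow> 'v monomial \<Rightarrow> nat" where
  "weighted_degree w m = (\<Sum>v\<in>Poly_Mapping.keys m. Poly_Mapping.lookup m v * w v)"

lemma weighted_degree_add: "weighted_degree w (m + n) = weighted_degree w m + weighted_degree w n"
  unfolding weighted_degree_def by (rule setsum_keys_plus_distrib) (simp_all add: algebra_simps)

lemma weighted_degree_single: "weighted_degree w (Poly_Mapping.single v k) = k * w v"
  by (simp add: weighted_degree_def)

lemma monomial_degree_add: "monomial_degree (m + n) = monomial_degree m + monomial_degree n"
  unfolding monomial_degree_def by (rule setsum_keys_plus_distrib) simp_all

lemma monomial_degree_single: "monomial_degree (Poly_Mapping.single v k) = k"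
  by (simp add: monomial_degree_def)

text \<open>A linear functional on polynomials. For a set \<open>E\<close> invariant under exchanges
  it vanishes on the ideal, so it serves as an obstruction to membership.\<close>

definition coeff_sum :: "'v monomial set \<Rightarrow> ('v, 'k::field) polynomial \<Rightarrow> 'k" where
  "coeff_sum E p = (\<Sum>m\<in>Poly_Mapping.keys p. if m \<in> E then Poly_Mapping.lookup p m else 0)"

lemma coeff_sum_add: "coeff_sum E (p + q) = coeff_sum E p + coeff_sum E q"
  unfolding coeff_sum_def by (rule setsum_keys_plus_distrib) simp_all

lemma coeff_sum_zero: "coeff_sum E 0 = 0"
  by (simp add: coeff_sum_def)

lemma coeff_sum_uminus: "coeff_sum E (- p) = - coeff_sum E p"
  using coeff_sum_add[of E p "- p"] by (simp add: coeff_sum_zero eq_neg_iff_add_eq_0 add.commute)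

lemma coeff_sum_sum: "coeff_sum E (sum f A) = (\<Sum>x\<in>A. coeff_sum E (f x))"
  by (induction A rule: infinite_finite_induct) (simp_all add: coeff_sum_zero coeff_sum_add)

lemma coeff_sum_single: "coeff_sum E (Poly_Mapping.single m c) = (if m \<in> E then c else 0)"
  by (simp add: coeff_sum_def)

lemma sum_single_lookup:
  "(\<Sum>m\<in>Poly_Mapping.keys p. Poly_Mapping.single m (Poly_Mapping.lookup p m)) = p"
  by (rule poly_mapping_eqI)
    (auto simp: lookup_sum lookup_single when_def in_keys_iff)

text \<open>Each term of \<open>q\<close> contributes its coefficient at \<open>m + s\<close> and
  the negative at \<open>m + t\<close>; both positions count or neither does.\<close>

lemma coeff_sum_times_binomial:
  assumes "\<And>m. m + s \<in> E \<longleftrightarrow> m + t \<in> E"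
  shows "coeff_sum E (q * (Poly_Mapping.single s 1 - Poly_Mapping.single t 1)) = 0"
proof -
  let ?c = "Poly_Mapping.lookup q"
  have "q * (Poly_Mapping.single s 1 - Poly_Mapping.single t 1) =
    (\<Sum>m\<in>Poly_Mapping.keys q. Poly_Mapping.single m (?c m)) *
      (Poly_Mapping.single s 1 - Poly_Mapping.single t 1)"
    by (simp only: sum_single_lookup)
  also have "\<dots> = (\<Sum>m\<in>Poly_Mapping.keys q.
      Poly_Mapping.single (m + s) (?c m) + - Poly_Mapping.single (m + t) (?c m))"
    by (simp add: sum_distrib_right right_diff_distrib mult_single sum_subtractf)
  finally show ?thesis
    by (simp only: coeff_sum_sum coeff_sum_add coeff_sum_uminus coeff_sum_single assms) simp
qed

section \<open>The polynomial ring and its ideals\<close>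

lemma poly_ring_simps:
  "p \<oplus>\<^bsub>poly_ring A\<^esub> q = p + q" "p \<otimes>\<^bsub>poly_ring A\<^esub> q = p * q"
  "\<zero>\<^bsub>poly_ring A\<^esub> = 0" "\<one>\<^bsub>poly_ring A\<^esub> = 1"
  "p \<in> carrier (poly_ring A) \<longleftrightarrow> (\<forall>m\<in>Poly_Mapping.keys p. Poly_Mapping.keys m \<subseteq> A)"
  by (simp_all add: poly_ring_def)

lemma poly_ring_a_inv:
  assumes "p \<in> carrier (poly_ring A)"
  shows "\<ominus>\<^bsub>poly_ring A\<^esub> p = - p"
proof -
  interpret cring "poly_ring A :: ('a, 'b) polynomial ring" by (rule cring_poly_ring)
  show ?thesis
    by (rule minus_equality) (use assms in \<open>simp_all add: poly_ring_simps\<close>)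
qed

text \<open>The kernel of \<open>coeff_sum E\<close> need not be an ideal. The polynomials all of
  whose multiples lie in the kernel do form one, and it contains \<open>G\<close>.\<close>

lemma coeff_sum_genideal:
  assumes G: "G \<subseteq> carrier (poly_ring A)"
    and zero: "\<And>g q. g \<in> G \<Longrightarrow> coeff_sum E (q * g) = 0"
    and p: "p \<in> Idl\<^bsub>poly_ring A\<^esub> G"
  shows "coeff_sum E p = 0"
proof -
  interpret cring "poly_ring A :: ('a, 'b) polynomial ring" by (rule cring_poly_ring)
  let ?S = "poly_ring A :: ('a, 'b) polynomial ring"
  let ?J = "{p \<in> carrier ?S. \<forall>q. coeff_sum E (q * p) = 0}"
  have "ideal ?J ?S"
  proof (rule idealI)
    show "subgroup ?J (add_monoid ?S)"
    proof (rule add.subgroupI)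
      show "?J \<noteq> {}"
        by (auto intro!: exI[of _ 0] simp: poly_ring_simps coeff_sum_zero)
      show "\<ominus>\<^bsub>?S\<^esub> p \<in> ?J" if "p \<in> ?J" for p
        using that a_inv_closed[of p] by (auto simp: poly_ring_a_inv coeff_sum_uminus)
      show "p \<oplus>\<^bsub>?S\<^esub> q \<in> ?J" if "p \<in> ?J" "q \<in> ?J" for p q
        using that a_closed[of p q]
        by (auto simp: poly_ring_simps(1) coeff_sum_add distrib_left)
    qed auto
    show "x \<otimes>\<^bsub>?S\<^esub> p \<in> ?J" if "p \<in> ?J" "x \<in> carrier ?S" for p x
      using that m_closed[of x p] by (auto simp: poly_ring_simps(2) mult.assoc[symmetric])
    then show "p \<otimes>\<^bsub>?S\<^esub> x \<in> ?J" if "p \<in> ?J" "x \<in> carrier ?S" for p x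
      using that by (simp add: m_comm)
  qed (rule ring_axioms)
  moreover have "G \<subseteq> ?J" using G zero by blast
  ultimately have "p \<in> ?J" using p genideal_minimal by blast
  then have "coeff_sum E (1 * p) = 0" by blast
  then show ?thesis by simp
qed

section \<open>The graded reverse lexicographic order and leading monomials\<close>

lemma grevlex_less_trans:
  assumes "grevlex_less indet_less s t" "grevlex_less indet_less t u"
  shows "grevlex_less indet_less s u"
proof (cases "monomial_degree s < monomial_degree u")
  case True
  then show ?thesis by (simp add: grevlex_less_def)
next
  case False
  with assms have deg: "monomial_degree s = monomial_degree u"
    by (auto simp: grevlex_less_def)
  with assms have "monomial_degree s = monomial_degree t" by (auto simp: grevlex_less_def)
  with deg assms obtain v w where
    v: "Poly_Mapping.lookup t v < Poly_Mapping.lookup s v"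
      "\<And>x. indet_less x v \<Longrightarrow> Poly_Mapping.lookup s x = Poly_Mapping.lookup t x" and
    w: "Poly_Mapping.lookup u w < Poly_Mapping.lookup t w"
      "\<And>x. indet_less x w \<Longrightarrow> Poly_Mapping.lookup t x = Poly_Mapping.lookup u x"
    by (auto simp: grevlex_less_def)
  have trans: "indet_less x z" if "indet_less x y" "indet_less y z" for x y z
    using that by (auto simp: indet_less_def split: prod.splits)
  have "v = w \<or> indet_less v w \<or> indet_less w v"
    by (cases v, cases w) (auto simp: indet_less_def)
  then consider "v = w" | "indet_less v w" | "indet_less w v" by blast
  \<comment> \<open>The smaller of the two deciding indeterminates \<open>v\<close> and
    \<open>w\<close> decides between \<open>s\<close> and \<open>u\<close>.\<close>
  then have "\<exists>x. Poly_Mapping.lookup u x < Poly_Mapping.lookup s x \<and>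
    (\<forall>y. indet_less y x \<longrightarrow> Poly_Mapping.lookup s y = Poly_Mapping.lookup u y)"
  proof cases
    case 1
    then show ?thesis using v w by (intro exI[of _ v]) auto
  next
    case 2
    then show ?thesis using v w trans by (intro exI[of _ v]) (metis)
  next
    case 3
    then show ?thesis using v w trans by (intro exI[of _ w]) (metis)
  qed
  with deg show ?thesis by (simp add: grevlex_less_def)
qed

lemma grevlex_less_irrefl: "\<not> grevlex_less lt s s"
  by (simp add: grevlex_less_def)

text \<open>\<open>indet_less\<close> is the lexicographic well-order on points, so there is a
  smallest indeterminate at which the exponents differ; it breaks a tie between the degrees.\<close>

lemma grevlex_less_total:
  assumes "s \<noteq> t"
  shows "grevlex_less indet_less s t \<or> grevlex_less indet_less t s"
proof -
  let ?D = "{v. Poly_Mapping.lookup s v \<noteq> Poly_Mapping.lookup t v}"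
  have "\<exists>v0. v0 \<in> ?D" using assms by (auto simp: poly_mapping_eq_iff fun_eq_iff)
  then obtain v where v: "v \<in> ?D" and "\<And>w. (w, v) \<in> less_than <*lex*> less_than \<Longrightarrow> w \<notin> ?D"
    using wfE_min[OF wf_lex_prod[OF wf_less_than wf_less_than], of _ ?D] by metis
  then have *: "Poly_Mapping.lookup s w = Poly_Mapping.lookup t w" if "indet_less w v" for w
    using that by (cases v, cases w) (auto simp: indet_less_def)
  from v consider "Poly_Mapping.lookup s v < Poly_Mapping.lookup t v"
    | "Poly_Mapping.lookup t v < Poly_Mapping.lookup s v" by fastforce
  then show ?thesis using * unfolding grevlex_less_def by (metis linorder_less_linear)
qed

lemma leading_monomial_eqI:
  assumes "m \<in> Poly_Mapping.keys p"
    and "\<And>m'. m' \<in> Poly_Mapping.keys p \<Longrightarrow> m' \<noteq> m \<Longrightarrow> grevlex_less indet_less m' m"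
  shows "leading_monomial (grevlex_less indet_less) p = m"
  unfolding leading_monomial_def
proof (rule the_equality)
  fix n
  assume "n \<in> Poly_Mapping.keys p \<and>
    (\<forall>m'\<in>Poly_Mapping.keys p. m' \<noteq> n \<longrightarrow> grevlex_less indet_less m' n)"
  then show "n = m" using assms grevlex_less_trans grevlex_less_irrefl by metis
qed (use assms in blast)

text \<open>A total and transitive relation has a greatest element on a finite non-empty set. For
  the monomials of \<open>p\<close> this justifies the definite description in
  \<open>leading_monomial\<close>.\<close>

lemma leading_monomial_exists:
  assumes "p \<noteq> 0"
  obtains m where "leading_monomial (grevlex_less indet_less) p = m" "m \<in> Poly_Mapping.keys p"
    "\<And>m'. m' \<in> Poly_Mapping.keys p \<Longrightarrow> m' \<noteq> m \<Longrightarrow> grevlex_less indet_less m' m"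
proof -
  have "\<exists>m\<in>M. \<forall>m'\<in>M. m' \<noteq> m \<longrightarrow> grevlex_less indet_less m' m" if "finite M" "M \<noteq> {}" for M
    using that
  proof (induction rule: finite_ne_induct)
    case (insert n M)
    then obtain m where "m \<in> M" "\<And>m'. m' \<in> M \<Longrightarrow> m' \<noteq> m \<Longrightarrow> grevlex_less indet_less m' m" by blast
    then show ?case
      using grevlex_less_total[of n m] grevlex_less_trans[of _ m n] insert.hyps
      by (metis insert_iff)
  qed simp
  moreover have "Poly_Mapping.keys p \<noteq> {}"
    using assms sum_single_lookup[of p] by force
  ultimately obtain m where "m \<in> Poly_Mapping.keys p"
    "\<And>m'. m' \<in> Poly_Mapping.keys p \<Longrightarrow> m' \<noteq> m \<Longrightarrow> grevlex_less indet_less m' m"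
    by (metis finite_keys)
  with leading_monomial_eqI that show thesis by blast
qed

section \<open>Rewriting anti-diagonal pairs\<close>

abbreviation var :: "point \<Rightarrow> point monomial" where
  "var v \<equiv> Poly_Mapping.single v 1"

text \<open>Reduction by an inner binomial with cofactor \<open>u\<close>. Since both terms of the
  binomial have coefficients 1 and -1, reducing a monomial gives a monomial again.\<close>

inductive exchange :: "cell set \<Rightarrow> point monomial \<Rightarrow> point monomial \<Rightarrow> bool" for P where
  exchangeI: "((i, j), (k, l)) \<in> inner_intervals P \<Longrightarrow>
    exchange P (var (i, l) + var (k, j) + u) (var (i, j) + var (k, l) + u)"

lemma exchange_add:
  assumes "exchange P m n"
  shows "exchange P (s + m) (s + n)"
  using assms
proof cases
  case (exchangeI i j k l u)
  then show ?thesis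
    using exchange.exchangeI[of i j k l P "s + u"] by (simp add: ac_simps)
qed

text \<open>In a degenerate rectangle the diagonal and the anti-diagonal pair coincide, so zero
  steps suffice; hence the closure in the conclusion.\<close>

lemma exchanges_filled:
  assumes "filled P i j k l"
  shows "(exchange P)\<^sup>*\<^sup>* (var (i, l) + var (k, j) + u) (var (i, j) + var (k, l) + u)"
proof (cases "i < k \<and> j < l")
  case True
  then show ?thesis
    using exchangeI[of i j k l P u] assms by (simp add: inner_intervals_iff r_into_rtranclp)
next
  case False
  then have "i = k \<or> j = l" using assms by (auto simp: filled_def)
  then show ?thesis by (auto simp: ac_simps)
qed

text \<open>The monomials enter through equations, so that reordering their factors becomes a goal
  for \<open>ac_simps\<close>.\<close>

lemma exchanges_filled':
  assumes "filled P i j k l" "m = var (i, l) + var (k, j) + u" "n = var (i, j) + var (k, l) + u"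
  shows "(exchange P)\<^sup>*\<^sup>* m n"
  using exchanges_filled assms by simp

section \<open>Joining two overlapping exchanges\<close>

definition joinable :: "('a \<Rightarrow> 'a \<Rightarrow> bool) \<Rightarrow> 'a \<Rightarrow> 'a \<Rightarrow> bool" where
  "joinable r x y \<longleftrightarrow> (\<exists>z. r\<^sup>*\<^sup>* x z \<and> r\<^sup>*\<^sup>* y z)"

lemma joinable_sym: "joinable r x y \<Longrightarrow> joinable r y x"
  unfolding joinable_def by blast

lemma joinableI: "r\<^sup>*\<^sup>* x z \<Longrightarrow> r\<^sup>*\<^sup>* y z \<Longrightarrow> joinable r x y"
  unfolding joinable_def by blast

text \<open>By symmetry let \<open>k1 \<le> k2\<close>. If \<open>j1 \<le> j2\<close>, each result
  needs one exchange, in the part of one interval that sticks out of the other, to reach a common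
  monomial.\<close>

lemma joinable_same_upper_left:
  assumes 1: "filled P i j1 k1 l" and 2: "filled P i j2 k2 l"
  shows "joinable (exchange P) (var (i, j1) + var (k1, l) + var (k2, j2) + u)
           (var (i, j2) + var (k2, l) + var (k1, j1) + u)"
proof -
  have *: "joinable (exchange P) (var (i, j1) + var (k1, l) + var (k2, j2) + u)
           (var (i, j2) + var (k2, l) + var (k1, j1) + u)"
    if 1: "filled P i j1 k1 l" and 2: "filled P i j2 k2 l" and k: "k1 \<le> k2" for j1 j2 k1 k2
  proof (cases "j1 \<le> j2")
    case True
    have a: "filled P k1 j2 k2 l" using 1 2 k by (intro filled_subset[OF 2]) (auto simp: filled_def)
    have b: "filled P i j1 k1 j2" using 1 2 True
      by (intro filled_subset[OF 1]) (auto simp: filled_def)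
    show ?thesis
      by (rule joinableI[OF exchanges_filled'[OF a, where u = "var (i, j1) + u"]
            exchanges_filled'[OF b, where u = "var (k2, l) + u"]])
        (simp_all only: ac_simps)
  next
    case False
    \<comment> \<open>Now the first interval lies in the second, and two exchanges turn the first
      result into the second.\<close>
    then have a: "filled P i j2 k2 j1" using 1 2 by (intro filled_subset[OF 2]) (auto simp: filled_def)
    have b: "filled P k1 j1 k2 l" using 1 2 k False
      by (intro filled_subset[OF 2]) (auto simp: filled_def)
    have "(exchange P)\<^sup>*\<^sup>* (var (i, j1) + var (k1, l) + var (k2, j2) + u)
      (var (i, j2) + var (k2, j1) + var (k1, l) + u)"
      by (rule exchanges_filled'[OF a, where u = "var (k1, l) + u"]) (simp_all only: ac_simps)
    also have "(exchange P)\<^sup>*\<^sup>* \<dots> (var (i, j2) + var (k2, l) + var (k1, j1) + u)"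
      by (rule exchanges_filled'[OF b, where u = "var (i, j2) + u"]) (simp_all only: ac_simps)
    finally show ?thesis by (rule joinableI) simp
  qed
  show ?thesis
    using *[OF 1 2] *[OF 2 1, THEN joinable_sym] by (meson linear)
qed

text \<open>Reflection in the main diagonal relates this to the case of a common upper-left vertex.
  For \<open>i1 \<le> i2\<close> and \<open>l2 < l1\<close> the second interval lies in the first,
  so the two-step path starts from the second result.\<close>

lemma joinable_same_lower_right:
  assumes 1: "filled P i1 j k l1" and 2: "filled P i2 j k l2"
  shows "joinable (exchange P) (var (i1, j) + var (k, l1) + var (i2, l2) + u)
           (var (i2, j) + var (k, l2) + var (i1, l1) + u)"
proof -
  have *: "joinable (exchange P) (var (i1, j) + var (k, l1) + var (i2, l2) + u)
           (var (i2, j) + var (k, l2) + var (i1, l1) + u)"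
    if 1: "filled P i1 j k l1" and 2: "filled P i2 j k l2" and i: "i1 \<le> i2" for i1 i2 l1 l2
  proof (cases "l1 \<le> l2")
    case True
    have a: "filled P i2 l1 k l2" using 1 2 True i
      by (intro filled_subset[OF 2]) (auto simp: filled_def)
    have b: "filled P i1 j i2 l1" using 1 2 i
      by (intro filled_subset[OF 1]) (auto simp: filled_def)
    show ?thesis
      by (rule joinableI[OF exchanges_filled'[OF a, where u = "var (i1, j) + u"]
            exchanges_filled'[OF b, where u = "var (k, l2) + u"]])
        (simp_all only: ac_simps)
  next
    case False
    have a: "filled P i1 j i2 l1" using 1 2 i
      by (intro filled_subset[OF 1]) (auto simp: filled_def)
    have b: "filled P i2 l2 k l1" using 1 2 i False
      by (intro filled_subset[OF 1]) (auto simp: filled_def)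
    have "(exchange P)\<^sup>*\<^sup>* (var (i2, j) + var (k, l2) + var (i1, l1) + u)
      (var (i1, j) + var (i2, l1) + var (k, l2) + u)"
      by (rule exchanges_filled'[OF a, where u = "var (k, l2) + u"]) (simp_all only: ac_simps)
    also have "(exchange P)\<^sup>*\<^sup>* \<dots> (var (i1, j) + var (k, l1) + var (i2, l2) + u)"
      by (rule exchanges_filled'[OF b, where u = "var (i1, j) + u"]) (simp_all only: ac_simps)
    finally show ?thesis by (rule joinableI[rotated]) simp
  qed
  show ?thesis
    using *[OF 1 2] *[OF 2 1, THEN joinable_sym] by (meson linear)
qed

text \<open>The third filled rectangle merges with each of the given two into a larger one; one
  exchange in each of these closes the diamond.\<close>

lemma joinable_opposite:
  assumes P: "corner_filling P" and less: "i < p" "p < k" "j < q" "q < l"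
    and NW: "filled P i q p l" and SE: "filled P p j k q"
  shows "joinable (exchange P) (var (i, q) + var (p, l) + var (k, j) + u)
           (var (p, j) + var (k, q) + var (i, l) + u)"
proof -
  consider (LL) "filled P i j p q" | (UR) "filled P p q k l"
    using P less NW SE unfolding corner_filling_def by blast
  then show ?thesis
  proof cases
    case LL
    note a = filled_append_horizontal[OF LL SE] and b = filled_append_vertical[OF LL NW]
    show ?thesis
      by (rule joinableI[OF exchanges_filled'[OF a, where u = "var (p, l) + u"]
            exchanges_filled'[OF b, where u = "var (k, q) + u"]])
        (simp_all only: ac_simps)
  next
    case UR
    note a = filled_append_vertical[OF SE UR] and b = filled_append_horizontal[OF NW UR]
    show ?thesis
      by (rule joinableI[OF exchanges_filled'[OF a, where u = "var (i, q) + u"]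
            exchanges_filled'[OF b, where u = "var (p, j) + u"]])
        (simp_all only: ac_simps)
  qed
qed

text \<open>Unique factorization of monomials, written additively: distinct indeterminates divide
  each other's cofactors, with a common quotient \<open>w\<close>.\<close>

lemma var_add_eqE:
  assumes "var x + u = var y + u'"
  obtains "x = y" "u = u'" | w where "x \<noteq> y" "u = var y + w" "u' = var x + w"
proof (cases "x = y")
  case True
  then show ?thesis using assms that by simp
next
  case False
  have eq: "Poly_Mapping.lookup (var x + u) v = Poly_Mapping.lookup (var y + u') v" for v using assms by simp
  \<comment> \<open>The truncated subtraction is exact: \<open>y\<close> differs from
    \<open>x\<close>, so it must occur in \<open>u\<close>.\<close>
  have "u = var y + (u - var y)"
  proof (rule poly_mapping_eqI)
    fix v
    show "Poly_Mapping.lookup u v = Poly_Mapping.lookup (var y + (u - var y)) v"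
      using eq[of v] False
      by (auto simp: lookup_add lookup_single when_def minus_poly_mapping.rep_eq split: if_splits)
  qed
  moreover have "u' = var x + (u - var y)"
  proof -
    have "var y + u' = var y + (var x + (u - var y))"
      using assms calculation by (metis add.left_commute)
    then show ?thesis by simp
  qed
  ultimately show ?thesis using that False by blast
qed

text \<open>Cancelling indeterminates with \<open>var_add_eqE\<close> sorts the pairs of exchanges
  by the vertices that their anti-diagonals share; each kind of overlap has its own joining
  lemma.\<close>

lemma exchange_locally_confluent:
  assumes P: "corner_filling P" and "exchange P m n1" "exchange P m n2"
  shows "joinable (exchange P) n1 n2"
  using assms(2)
proof cases
  case (exchangeI i1 j1 k1 l1 u1)
  note e1 = this
  from assms(3) show ?thesis
  proof cases
    case (exchangeI i2 j2 k2 l2 u2)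
    note e2 = this
    have f: "filled P i1 j1 k1 l1" "filled P i2 j2 k2 l2"
      and less: "i1 < k1" "j1 < l1" "i2 < k2" "j2 < l2"
      using e1 e2 by (auto simp: inner_intervals_iff)
    have "var (i1, l1) + (var (k1, j1) + u1) = var (i2, l2) + (var (k2, j2) + u2)"
      using e1 e2 by (simp add: add.assoc)
    then show ?thesis
    proof (cases rule: var_add_eqE)
      case 1
      note upper_left = 1
      from 1(2) show ?thesis
      proof (cases rule: var_add_eqE)
        case 1
        then show ?thesis using upper_left e1 e2 by (auto intro: joinableI)
      next
        case (2 w)
        have "joinable (exchange P) (var (i1, j1) + var (k1, l1) + var (k2, j2) + w)
           (var (i1, j2) + var (k2, l1) + var (k1, j1) + w)"
          using joinable_same_upper_left[of P i1 j1 k1 l1 j2 k2 w] f upper_left by simp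
        then show ?thesis using upper_left 2 e1 e2 by (simp add: add.assoc)
      qed
    next
      case (2 w)
      from 2(2) have "var (k1, j1) + u1 = var (i2, l2) + w" .
      then show ?thesis
      proof (cases rule: var_add_eqE)
        case 1
        note opposite = 1
        have "var (k2, j2) + u2 = var (i1, l1) + u1" using 2 1 by simp
        then show ?thesis
        proof (cases rule: var_add_eqE)
          case 1
          \<comment> \<open>Impossible, since it would give
            \<open>i1 < k1 = i2 < k2 = i1\<close>.\<close>
          then show ?thesis using opposite less by simp
        next
          case (2 w')
          have "joinable (exchange P) (var (i1, l2) + var (i2, l1) + var (k2, j2) + w')
            (var (i2, j2) + var (k2, l2) + var (i1, l1) + w')"
            using joinable_opposite[of P i1 i2 k2 j2 l2 l1 w'] P f opposite less by simp
          then show ?thesis using opposite 2 e1 e2 by (simp add: add.assoc)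
        qed
      next
        case (2 w1)
        note w1 = this
        have "var (k2, j2) + u2 = var (i1, l1) + (var (k1, j1) + w1)"
          using \<open>var (k2, j2) + u2 = var (i1, l1) + w\<close> 2 by simp
        then show ?thesis
        proof (cases rule: var_add_eqE)
          case 1
          \<comment> \<open>The opposite overlap again, with the two intervals in exchanged
            roles.\<close>
          have "joinable (exchange P) (var (i2, j2) + var (k2, l2) + var (k1, j1) + w1)
            (var (i1, j1) + var (k1, l1) + var (i2, l2) + w1)"
            using joinable_opposite[of P i2 i1 k1 j1 l1 l2 w1] P f 1 less by simp
          then have "joinable (exchange P) n2 n1"
            using 1 2 e1 e2 by (simp add: add.assoc)
          then show ?thesis by (rule joinable_sym)
        next
          case (2 w2)
          from 2(3) have "var (k1, j1) + w1 = var (k2, j2) + w2" .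
          then show ?thesis
          proof (cases rule: var_add_eqE)
            case 1
            have "joinable (exchange P) (var (i1, j1) + var (k1, l1) + var (i2, l2) + w1)
              (var (i2, j1) + var (k1, l2) + var (i1, l1) + w1)"
              using joinable_same_lower_right[of P i1 j1 k1 l1 i2 l2 w1] f 1 by simp
            then show ?thesis using 1 2 w1 e1 e2 by (simp add: add.assoc)
          next
            case (2 w3)
            \<comment> \<open>No indeterminate is shared, so both anti-diagonal pairs divide the
              monomial together and the exchanges commute.\<close>
            have n1: "n1 = var (i2, l2) + var (k2, j2) + (var (i1, j1) + var (k1, l1) + w3)"
              using 2 w1 e1 by (simp add: ac_simps)
            have n2: "n2 = var (i1, l1) + var (k1, j1) + (var (i2, j2) + var (k2, l2) + w3)"
              using 2 \<open>u2 = _\<close> e2 by (simp add: ac_simps)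
            show ?thesis unfolding n1 n2
              by (intro joinableI[OF exchanges_filled'[OF f(2) refl refl]
                    exchanges_filled'[OF f(1) refl]])
                (simp_all only: ac_simps)
          qed
        qed
      qed
    qed
  qed
qed

section \<open>Groebner bases\<close>

text \<open>Each exchange moves the two points closer to the main diagonal in total, so the weight
  $(x-y)^2$ witnesses termination.\<close>

definition spread :: "point \<Rightarrow> nat" where
  "spread = (\<lambda>(x, y). nat ((int x - int y)\<^sup>2))"

text \<open>Over the integers the two sides differ by twice
  \<open>(k - i) * (l - j)\<close>.\<close>

lemma spread_exchange:
  assumes "i < k" "j < l"
  shows "spread (i, j) + spread (k, l) < spread (i, l) + spread (k, j)"
proof -
  have "0 < (int k - int i) * (int l - int j)" using assms by simp
  then have "(int i - int j)\<^sup>2 + (int k - int l)\<^sup>2 < (int i - int l)\<^sup>2 + (int k - int j)\<^sup>2"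
    by (simp add: power2_eq_square algebra_simps)
  then have "int (spread (i, j) + spread (k, l)) < int (spread (i, l) + spread (k, j))"
    by (simp add: spread_def)
  then show ?thesis by (simp only: of_nat_less_iff)
qed

lemma exchange_decreases_spread:
  assumes "exchange P m n"
  shows "weighted_degree spread n < weighted_degree spread m"
  using assms
proof cases
  case (exchangeI i j k l u)
  then show ?thesis
    using spread_exchange[of i k j l]
    by (simp add: weighted_degree_add weighted_degree_single inner_intervals_iff)
qed

text \<open>The degrees agree, and \<open>(i, j)\<close> is the smallest of the four corners. It
  belongs to the diagonal pair, so the reverse lexicographic rule makes the diagonal monomial
  smaller.\<close>

lemma exchange_grevlex_less:
  assumes "exchange P m n"
  shows "grevlex_less indet_less n m"
  using assms
proof cases
  case (exchangeI i j k l u)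
  then have "i < k" "j < l" by (simp_all add: inner_intervals_iff)
  then show ?thesis
    unfolding exchangeI(1,2) grevlex_less_def
    by (intro disjI2 conjI exI[of _ "(i, j)"])
      (auto simp: monomial_degree_add monomial_degree_single lookup_add lookup_single when_def
        indet_less_def)
qed

lemma exchanges_grevlex_less:
  assumes "(exchange P)\<^sup>*\<^sup>* m n" "m \<noteq> n"
  shows "grevlex_less indet_less n m"
  using assms
proof (induction rule: converse_rtranclp_induct)
  case (step m m')
  then show ?case using exchange_grevlex_less grevlex_less_trans by metis
qed simp

section \<open>Interval binomials and the ideal they generate\<close>

lemma interval_binomial_eq:
  "interval_binomial (i, j) (k, l) =
     Poly_Mapping.single (var (i, j) + var (k, l)) 1 - Poly_Mapping.single (var (i, l) + var (k, j)) 1"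
  by (simp add: interval_binomial_def indet_def mult_single)

lemma keys_single_diff_single:
  assumes "s \<noteq> t"
  shows "Poly_Mapping.keys (Poly_Mapping.single s (1::'k::field) - Poly_Mapping.single t 1) = {s, t}"
  using assms by (auto simp: in_keys_iff lookup_minus lookup_single when_def split: if_splits)

lemma interval_binomial_props:
  fixes f :: "(point, 'k::field) polynomial"
  assumes "((i, j), (k, l)) \<in> inner_intervals P"
  defines "f \<equiv> interval_binomial (i, j) (k, l)"
  shows "f \<in> carrier (poly_ring (vertices P))" "f \<noteq> 0"
    "leading_monomial (grevlex_less indet_less) f = var (i, l) + var (k, j)"
proof -
  have less: "i < k" "j < l" and fill: "filled P i j k l"
    using assms by (simp_all add: inner_intervals_iff)
  have ex: "exchange P (var (i, l) + var (k, j)) (var (i, j) + var (k, l))"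
    using exchange.exchangeI[OF assms(1), of 0] by simp
  have gr: "grevlex_less indet_less (var (i, j) + var (k, l)) (var (i, l) + var (k, j))"
    by (rule exchange_grevlex_less[OF ex])
  then have ne: "var (i, j) + var (k, l) \<noteq> var (i, l) + var (k, j)"
    using grevlex_less_irrefl by metis
  have keys: "Poly_Mapping.keys f = {var (i, j) + var (k, l), var (i, l) + var (k, j)}"
    unfolding f_def interval_binomial_eq by (rule keys_single_diff_single[OF ne])
  show "f \<noteq> 0" using keys by auto
  show "leading_monomial (grevlex_less indet_less) f = var (i, l) + var (k, j)"
    by (rule leading_monomial_eqI) (use keys gr in auto)
  have "Poly_Mapping.keys (var p + var q) \<subseteq> vertices P" if "p \<in> vertices P" "q \<in> vertices P" for p q
    using Poly_Mapping.keys_add[of "var p" "var q"] that by auto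
  then show "f \<in> carrier (poly_ring (vertices P))"
    unfolding poly_ring_simps keys using filled_corners_in_vertices[OF less fill] by simp
qed

lemma finite_inner_intervals:
  assumes "finite P"
  shows "finite (inner_intervals P)"
proof (rule finite_subset)
  show "inner_intervals P \<subseteq> vertices P \<times> vertices P" by (auto simp: inner_intervals_def)
  show "finite (vertices P \<times> vertices P)"
    using assms by (auto simp: vertices_def cell_vertices_def)
qed

text \<open>Multiplying both monomials of a generator by the same monomial yields an exchange, so
  \<open>E\<close> contains both products or neither.\<close>

lemma coeff_sum_cells_ideal:
  fixes p :: "(point, 'k::field) polynomial"
  assumes "\<And>m n. exchange P m n \<Longrightarrow> m \<in> E \<longleftrightarrow> n \<in> E"
    and p: "p \<in> cells_ideal (poly_ring (vertices P)) P"
  shows "coeff_sum E p = 0"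
proof (rule coeff_sum_genideal)
  show "p \<in> Idl\<^bsub>poly_ring (vertices P)\<^esub> inner_binomials P"
    using p by (simp add: cells_ideal_def)
  show "inner_binomials P \<subseteq> carrier (poly_ring (vertices P))"
    using interval_binomial_props(1) by (fastforce simp: inner_binomials_def)
  show "coeff_sum E (q * g) = 0" if g': "g \<in> inner_binomials P" for g q :: "(point, 'k) polynomial"
  proof -
    obtain i j k l where ijkl: "((i, j), (k, l)) \<in> inner_intervals P"
      and g: "g = interval_binomial (i, j) (k, l)"
      using g' unfolding inner_binomials_def by auto
    have "exchange P (m + (var (i, l) + var (k, j))) (m + (var (i, j) + var (k, l)))" for m
      using exchange_add[OF exchange.exchangeI[OF ijkl, of 0], of m] by simp
    then show ?thesis
      unfolding g interval_binomial_eq using assms(1) by (intro coeff_sum_times_binomial) blast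
  qed
qed

text \<open>For a monomial $m$ without exchanges, the coefficients of the monomials with normal form
  $m$ sum to zero. If $m$ is the leading monomial, then it is the only such monomial that occurs,
  as exchanges decrease monomials.\<close>

lemma leading_monomial_reducible:
  fixes f :: "(point, 'k::field) polynomial"
  assumes P: "corner_filling P" and f: "f \<in> cells_ideal (poly_ring (vertices P)) P" "f \<noteq> 0"
  shows "\<exists>n. exchange P (leading_monomial (grevlex_less indet_less) f) n"
proof (rule ccontr)
  obtain m where m: "leading_monomial (grevlex_less indet_less) f = m" "m \<in> Poly_Mapping.keys f"
    "\<And>m'. m' \<in> Poly_Mapping.keys f \<Longrightarrow> m' \<noteq> m \<Longrightarrow> grevlex_less indet_less m' m"
    by (rule leading_monomial_exists[OF f(2)]) blast
  assume "\<nexists>n. exchange P (leading_monomial (grevlex_less indet_less) f) n"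
  with m have normal: "\<not> exchange P m n" for n by simp
  let ?E = "{s. (exchange P)\<^sup>*\<^sup>* s m}"
  have "s \<in> ?E \<longleftrightarrow> t \<in> ?E" if st: "exchange P s t" for s t
  proof
    assume "s \<in> ?E"
    then have "(exchange P)\<^sup>*\<^sup>* s m" by simp
    \<comment> \<open>Confluence is used here: \<open>m\<close> remains reachable after the step
      from \<open>s\<close> to \<open>t\<close>. The converse merely prepends that step.\<close>
    then have "(exchange P)\<^sup>*\<^sup>* t m"
    proof (rule exchanges_to_normal_form[where \<mu> = "weighted_degree spread", rotated 3])
      show "\<exists>w. (exchange P)\<^sup>*\<^sup>* y w \<and> (exchange P)\<^sup>*\<^sup>* z w" if "exchange P x y" "exchange P x z" for x y z
        using exchange_locally_confluent[OF P that] by (simp add: joinable_def)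
    qed (use st normal exchange_decreases_spread in auto)
    then show "t \<in> ?E" by simp
  qed (use st converse_rtranclp_into_rtranclp in auto)
  then have "coeff_sum ?E f = 0" using f(1) by (rule coeff_sum_cells_ideal)
  moreover have "coeff_sum ?E f = (\<Sum>s\<in>{m}. Poly_Mapping.lookup f s)"
    unfolding coeff_sum_def
  proof (rule sum.mono_neutral_cong_right)
    \<comment> \<open>Another monomial of \<open>f\<close> with normal form \<open>m\<close> would
      be greater than \<open>m\<close>, which is the leading one.\<close>
    show "\<forall>s\<in>Poly_Mapping.keys f - {m}. (if s \<in> ?E then Poly_Mapping.lookup f s else 0) = 0"
      using m(3) exchanges_grevlex_less grevlex_less_trans grevlex_less_irrefl
      by (metis DiffE insertI1 mem_Collect_eq)
  qed (use m(2) in auto)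
  ultimately show False using m(2) by (simp add: in_keys_iff)
qed

text \<open>Since the generators lie in the ideal, one inclusion of initial ideals is monotonicity.
  For the other, a reducible leading monomial is a multiple of the leading monomial of an inner
  binomial.\<close>

theorem inner_binomials_groebner_basis:
  assumes fin: "finite P" and P: "corner_filling P"
  shows "groebner_basis (poly_ring (vertices P) :: (point, 'k::field) polynomial ring)
    (grevlex_less indet_less) (inner_binomials P) (cells_ideal (poly_ring (vertices P)) P)"
proof -
  let ?S = "poly_ring (vertices P) :: (point, 'k) polynomial ring"
  let ?lt = "grevlex_less indet_less"
  let ?G = "inner_binomials P :: (point, 'k) polynomial set"
  let ?I = "cells_ideal ?S P"
  let ?in = "\<lambda>F. {Poly_Mapping.single (leading_monomial ?lt f) (1::'k) | f. f \<in> F \<and> f \<noteq> 0}"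
  interpret cring ?S by (rule cring_poly_ring)
  have G: "?G \<subseteq> carrier ?S" "0 \<notin> ?G"
    using interval_binomial_props(1,2) by (fastforce simp: inner_binomials_def)+
  have "finite ?G"
  proof -
    have "?G = (\<lambda>(a, b). interval_binomial a b) ` inner_intervals P"
      by (auto simp: inner_binomials_def)
    then show ?thesis using finite_inner_intervals[OF fin] by simp
  qed
  moreover have GI: "?G \<subseteq> ?I" unfolding cells_ideal_def by (rule genideal_self[OF G(1)])
  moreover have I: "?I \<subseteq> carrier ?S"
    unfolding cells_ideal_def using ideal.Icarr[OF genideal_ideal[OF G(1)]] by blast
  have in_carr: "?in F \<subseteq> carrier ?S" if "F \<subseteq> carrier ?S" for F
  proof
    fix s assume "s \<in> ?in F"
    then obtain f where f: "s = Poly_Mapping.single (leading_monomial ?lt f) 1" "f \<in> F" "f \<noteq> 0"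
      by blast
    have "leading_monomial ?lt f \<in> Poly_Mapping.keys f"
      using leading_monomial_exists[OF f(3)] by metis
    moreover have "f \<in> carrier ?S" using that f(2) by blast
    ultimately have "Poly_Mapping.keys (leading_monomial ?lt f) \<subseteq> vertices P"
      unfolding poly_ring_simps(5) by blast
    then show "s \<in> carrier ?S" by (simp add: f(1) poly_ring_simps(5))
  qed
  have "Idl\<^bsub>?S\<^esub> (?in ?G) = Idl\<^bsub>?S\<^esub> (?in ?I)"
  proof (rule antisym)
    have idl: "ideal (Idl\<^bsub>?S\<^esub> (?in F)) ?S" and sub: "?in F \<subseteq> Idl\<^bsub>?S\<^esub> (?in F)"
      if "F \<subseteq> carrier ?S" for F
      by (rule genideal_ideal[OF in_carr[OF that]]) (rule genideal_self[OF in_carr[OF that]])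
    show "Idl\<^bsub>?S\<^esub> (?in ?G) \<subseteq> Idl\<^bsub>?S\<^esub> (?in ?I)"
      using GI sub[OF I] by (intro genideal_minimal[OF idl[OF I]]) blast
    show "Idl\<^bsub>?S\<^esub> (?in ?I) \<subseteq> Idl\<^bsub>?S\<^esub> (?in ?G)"
    proof (rule genideal_minimal[OF idl[OF G(1)]], rule subsetI)
      fix s assume s: "s \<in> ?in ?I"
      obtain f where f: "s = Poly_Mapping.single (leading_monomial ?lt f) 1" "f \<in> ?I" "f \<noteq> 0"
        using s by blast
      then obtain n where "exchange P (leading_monomial ?lt f) n"
        using leading_monomial_reducible[OF P] by blast
      then obtain i j k l u where ijkl: "((i, j), (k, l)) \<in> inner_intervals P"
        and lm: "leading_monomial ?lt f = var (i, l) + var (k, j) + u"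
        by (auto elim: exchange.cases)
      let ?g = "interval_binomial (i, j) (k, l) :: (point, 'k) polynomial"
      have "?g \<in> ?G" using ijkl unfolding inner_binomials_def by blast
      then have "Poly_Mapping.single (leading_monomial ?lt ?g) 1 \<in> ?in ?G"
        using interval_binomial_props(2)[OF ijkl] by (intro CollectI exI[of _ ?g] conjI refl)
      then have "Poly_Mapping.single (leading_monomial ?lt ?g) 1 \<in> Idl\<^bsub>?S\<^esub> (?in ?G)"
        using sub[OF G(1)] by (rule rev_subsetD)
      then have g: "Poly_Mapping.single (var (i, l) + var (k, j)) 1 \<in> Idl\<^bsub>?S\<^esub> (?in ?G)"
        by (simp only: interval_binomial_props(3)[OF ijkl])
      \<comment> \<open>The cofactor \<open>u\<close> divides a monomial over
        \<open>vertices P\<close>, so multiplication by it stays in the ring.\<close>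
      have "s \<in> carrier ?S" by (rule subsetD[OF in_carr[OF I] s])
      then have "Poly_Mapping.keys (var (i, l) + var (k, j) + u) \<subseteq> vertices P"
        unfolding f(1) lm poly_ring_simps(5) by simp
      moreover have "Poly_Mapping.keys u \<subseteq> Poly_Mapping.keys (var (i, l) + var (k, j) + u)"
        by (simp add: subset_iff in_keys_iff lookup_add)
      ultimately have "Poly_Mapping.single u 1 \<in> carrier ?S"
        unfolding poly_ring_simps(5) by simp
      from ideal.I_l_closed[OF idl[OF G(1)] g this]
      show "s \<in> Idl\<^bsub>?S\<^esub> (?in ?G)"
        unfolding poly_ring_simps(2) mult_single f(1) lm by (simp only: ac_simps mult_1)
    qed
  qed
  ultimately show ?thesis
    using G(2) by (simp add: groebner_basis_def initial_ideal_def)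
qed

theorem proposition6p4:
  fixes Q Q' P Q1 Q2 :: "cell set"
    and S :: "(point, 'k::field) polynomial ring"
    and vs :: "point list list"
    and a b :: nat
  assumes "parallelogram_polyomino Q"
    and "sub_polyomino Q' Q" and "parallelogram_polyomino Q'"
    and "P = Q - Q'" and "P \<noteq> {}"
    and "S = poly_ring (vertices P)"
    and "antidiagonal_partition P vs"
    and "a = Min {i. i < length vs \<and> set (vs ! i) \<inter> vertices Q' \<noteq> {}}"
    and "b = Max {i. i < length vs \<and> set (vs ! i) \<inter> vertices Q' \<noteq> {}}"
    and "Q1 = (\<Union>i\<in>{i. i < length vs \<and> i < b}. antidiagonal_cells P (vs ! i))"
    and "Q2 = (\<Union>i\<in>{i. i < length vs \<and> i > a}. antidiagonal_cells P (vs ! i))"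
    and "cells_ideal S Q1 <+>\<^bsub>S\<^esub> cells_ideal S Q2 = cells_ideal S P"
  shows "groebner_basis S (grevlex_less indet_less) (inner_binomials P) (cells_ideal S P)"
proof -
  have "finite P"
    using assms(1,4) by (auto simp: parallelogram_polyomino_def polyomino_def)
  moreover have "corner_filling P"
    using assms(1,3,4) corner_filling_Diff_parallelogram by simp
  ultimately show ?thesis
    unfolding assms(6) by (rule inner_binomials_groebner_basis)
qed

end
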